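(* Let $g>0$, $R>0$, $H,l_z\in\mathbb{R}$ and $\vartheta\in[0,\pi]$ be such that $H-R\cos\vartheta>0$ and $gR^2\sin^2(\vartheta)\,(H-R\cos\vartheta)\ge l_z^2$. Consider the flight parabolas with parameters $(H,R,l_z)$ and polar angle $\vartheta$ (as defined in the context). Points of these flight parabolas at distance $r\ge 0$ from the $z$-axis exist only if $$r\ge \frac{|l_z|}{\sqrt{g(H-R\cos\vartheta)}},$$ and for every such $r$ the set of heights ($z$-coordinates) of the points of these flight parabolas at distance $r$ from the $z$-axis is exactly $\{h_+(r,\vartheta),h_-(r,\vartheta)\}$, where $$h_\pm(r,\vartheta)=\frac{H+R\cos\vartheta}{2}-\frac g2\left(\frac{\sqrt{r^2 g(H-R\cos\vartheta)-l_z^2}\pm\sqrt{R^2\sin^2(\vartheta)\, g(H-R\cos\vartheta)-l_z^2}}{g(H-R\cos\vartheta)}\right)^2 .$$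
   Context: A point particle moves under constant gravity $-g\vec e_z$ in $\mathbb{R}^3$. A flight parabola is a curve $\vec r(t)=-\tfrac12 g t^2\vec e_z+\vec v_S t+\vec S$, $t\in\mathbb{R}$ (the whole parabola is considered; any obstruction by a boundary is ignored), where $\vec S$ is the vertex (highest point) and $\vec v_S$ is the horizontal velocity vector at the vertex. Its focal length is $F=\frac{|\vec v_S|^2}{2g}$ and its focus is $\vec F=\vec S-F\vec e_z$. Its energy height is $H=\frac{|\vec v_S|^2}{2g}+z_S$, where $z_S$ is the $z$-coordinate of $\vec S$. Its reduced angular momentum is $l_z=(\vec S\times\vec v_S)_z$. A flight parabola with parameters $(H,R,l_z)$ and polar angle $\vartheta$ is one with energy height $H$ and reduced angular momentum $l_z$ whose focus lies on the sphere of radius $R$ about the origin at polar angle $\vartheta$, i.e. $\vec F=R(\cos\varphi\sin\vartheta,\sin\varphi\sin\vartheta,\cos\vartheta)^T$ for some azimuth $\varphi\in\mathbb{R}$. Equivalently, for some $\varphi$, $$\vec S=\left(R\cos\varphi\sin\vartheta,\;R\sin\varphi\sin\vartheta,\;\tfrac{H+R\cos\vartheta}{2}\right)^T,\qquad |\vec v_S|=\sqrt{g(H-R\cos\vartheta)},\qquad (\vec S\times\vec v_S)_z=l_z .$$ The distance of a point $(x,y,z)$ from the $z$-axis is $r=\sqrt{x^2+y^2}$. *)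

theory Defs
  imports "HOL-Analysis.Analysis"
begin

definition e_z :: "real^3" where
  "e_z = axis 3 1"

text \<open>For \<open>g > 0\<close> and a horizontal velocity \<open>v\<close> (that is, \<open>v $ 3 = 0\<close>), \<open>S\<close> is the highest point
  of the curve \<open>flight_curve g S v\<close>, reached at time \<open>0\<close> with velocity \<open>v\<close>. Horizontality is
  imposed in \<open>flight_parabolas\<close> below.\<close>

definition flight_curve :: "real \<Rightarrow> real^3 \<Rightarrow> real^3 \<Rightarrow> real \<Rightarrow> real^3" where
  "flight_curve g S v t = - ((1/2) * g * t\<^sup>2) *\<^sub>R e_z + t *\<^sub>R v + S"

definition focal_length :: "real \<Rightarrow> real^3 \<Rightarrow> real" where
  "focal_length g v = (norm v)\<^sup>2 / (2 * g)"

definition parabola_focus :: "real \<Rightarrow> real^3 \<Rightarrow> real^3 \<Rightarrow> real^3" where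
  "parabola_focus g S v = S - focal_length g v *\<^sub>R e_z"

definition energy_height :: "real \<Rightarrow> real^3 \<Rightarrow> real^3 \<Rightarrow> real" where
  "energy_height g S v = (norm v)\<^sup>2 / (2 * g) + S $ 3"

definition reduced_angular_momentum :: "real^3 \<Rightarrow> real^3 \<Rightarrow> real" where
  "reduced_angular_momentum S v = cross3 S v $ 3"

definition sphere_point :: "real \<Rightarrow> real \<Rightarrow> real \<Rightarrow> real^3" where
  "sphere_point R \<phi> \<theta> =
     R *\<^sub>R vector [cos \<phi> * sin \<theta>, sin \<phi> * sin \<theta>, cos \<theta>]"

text \<open>The azimuth \<open>\<phi>\<close> of the focus is not a parameter: parabolas of all azimuths are included.\<close>

definition flight_parabolas ::
    "real \<Rightarrow> real \<Rightarrow> real \<Rightarrow> real \<Rightarrow> real \<Rightarrow> (real \<Rightarrow> real^3) set" where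
  "flight_parabolas g H R l \<theta> =
     {flight_curve g S v | S v.
        v $ 3 = 0 \<and>
        energy_height g S v = H \<and>
        reduced_angular_momentum S v = l \<and>
        (\<exists>\<phi>. parabola_focus g S v = sphere_point R \<phi> \<theta>)}"

definition flight_points :: "real \<Rightarrow> real \<Rightarrow> real \<Rightarrow> real \<Rightarrow> real \<Rightarrow> (real^3) set" where
  "flight_points g H R l \<theta> = (\<Union>c \<in> flight_parabolas g H R l \<theta>. range c)"

definition axis_dist :: "real^3 \<Rightarrow> real" where
  "axis_dist p = sqrt ((p $ 1)\<^sup>2 + (p $ 2)\<^sup>2)"

definition h_plus :: "real \<Rightarrow> real \<Rightarrow> real \<Rightarrow> real \<Rightarrow> real \<Rightarrow> real \<Rightarrow> real" where
  "h_plus g H R l r \<theta> =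
     (H + R * cos \<theta>) / 2 - g / 2 *
       ((sqrt (r\<^sup>2 * g * (H - R * cos \<theta>) - l\<^sup>2)
           + sqrt (R\<^sup>2 * (sin \<theta>)\<^sup>2 * g * (H - R * cos \<theta>) - l\<^sup>2))
         / (g * (H - R * cos \<theta>)))\<^sup>2"

definition h_minus :: "real \<Rightarrow> real \<Rightarrow> real \<Rightarrow> real \<Rightarrow> real \<Rightarrow> real \<Rightarrow> real" where
  "h_minus g H R l r \<theta> =
     (H + R * cos \<theta>) / 2 - g / 2 *
       ((sqrt (r\<^sup>2 * g * (H - R * cos \<theta>) - l\<^sup>2)
           - sqrt (R\<^sup>2 * (sin \<theta>)\<^sup>2 * g * (H - R * cos \<theta>) - l\<^sup>2))
         / (g * (H - R * cos \<theta>)))\<^sup>2"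

end

theory Submission
  imports Defs
begin

text \<open>
  Write \<open>K = g (H - R cos \<theta>)\<close>, the squared vertex speed, and \<open>\<rho> = R sin \<theta>\<close>. Projected to the
  horizontal plane, a parabola is the line \<open>S + t v\<close> with \<open>|S| = \<rho>\<close>, \<open>|v|\<^sup>2 = K\<close> and \<open>S \<times> v = l\<close>.
  Lagrange's identity at time \<open>0\<close> and at time \<open>t\<close> gives \<open>(S \<bullet> v)\<^sup>2 + l\<^sup>2 = K \<rho>\<^sup>2\<close> and
  \<open>(S \<bullet> v + K t)\<^sup>2 + l\<^sup>2 = K r\<^sup>2\<close>. Hence \<open>K r\<^sup>2 \<ge> l\<^sup>2\<close>, and both \<open>S \<bullet> v\<close> and \<open>S \<bullet> v + K t\<close> are
  determined up to sign, which leaves two values for \<open>t\<^sup>2\<close> and therefore two heights. The lines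
  with \<open>v\<close> along the first axis attain both.
\<close>

text \<open>Eliminates the azimuth. Conversely, it is recovered as the argument of the complex
  number with parts \<open>p $ 1\<close> and \<open>p $ 2\<close>; the sign assumption makes
  \<open>R * sin \<theta>\<close> its modulus.\<close>

lemma sphere_point_azimuth_iff:
  assumes "0 \<le> R * sin \<theta>"
  shows "(\<exists>\<phi>. p = sphere_point R \<phi> \<theta>) \<longleftrightarrow>
    (p $ 1)\<^sup>2 + (p $ 2)\<^sup>2 = (R * sin \<theta>)\<^sup>2 \<and> p $ 3 = R * cos \<theta>"
proof
  assume "\<exists>\<phi>. p = sphere_point R \<phi> \<theta>"
  then obtain \<phi> where p: "p = sphere_point R \<phi> \<theta>" ..
  have "(p $ 1)\<^sup>2 + (p $ 2)\<^sup>2 = (R * sin \<theta>)\<^sup>2 * ((cos \<phi>)\<^sup>2 + (sin \<phi>)\<^sup>2)"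
    unfolding distrib_left by (simp add: p sphere_point_def power_mult_distrib)
  then show "(p $ 1)\<^sup>2 + (p $ 2)\<^sup>2 = (R * sin \<theta>)\<^sup>2 \<and> p $ 3 = R * cos \<theta>"
    by (simp add: p sphere_point_def)
next
  assume a: "(p $ 1)\<^sup>2 + (p $ 2)\<^sup>2 = (R * sin \<theta>)\<^sup>2 \<and> p $ 3 = R * cos \<theta>"
  define z where "z = Complex (p $ 1) (p $ 2)"
  have "cmod z = R * sin \<theta>"
    using a assms by (simp add: z_def cmod_def)
  then have "z = rcis (R * sin \<theta>) (Arg z)"
    by (metis rcis_cmod_Arg)
  then have "p $ 1 = R * sin \<theta> * cos (Arg z)" "p $ 2 = R * sin \<theta> * sin (Arg z)"
    by (metis z_def complex.sel(1) Re_rcis, metis z_def complex.sel(2) Im_rcis)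
  then have "p = sphere_point R (Arg z) \<theta>"
    using a by (simp add: vec_eq_iff forall_3 sphere_point_def)
  then show "\<exists>\<phi>. p = sphere_point R \<phi> \<theta>" ..
qed

text \<open>Here (x, y) is the horizontal position of the vertex and (u, w) the velocity. With focal
  length F, the vertex lies F above the focus and F below height \<open>H\<close>. It is therefore
  midway between \<open>R * cos \<theta>\<close> and \<open>H\<close>, and 2 F =
  \<open>H - R * cos \<theta>\<close> fixes the squared speed.\<close>

lemma mem_flight_points_iff:
  assumes "g > 0" and "0 \<le> R * sin \<theta>"
  shows "p \<in> flight_points g H R l \<theta> \<longleftrightarrow>
    (\<exists>x y u w t. x\<^sup>2 + y\<^sup>2 = (R * sin \<theta>)\<^sup>2 \<and> u\<^sup>2 + w\<^sup>2 = g * (H - R * cos \<theta>) \<and>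
       x * w - y * u = l \<and> p $ 1 = x + t * u \<and> p $ 2 = y + t * w \<and>
       p $ 3 = (H + R * cos \<theta>) / 2 - g / 2 * t\<^sup>2)"
    (is "_ \<longleftrightarrow> ?coordinates")
proof
  assume "p \<in> flight_points g H R l \<theta>"
  then obtain S v t where p: "p = flight_curve g S v t" and v3: "v $ 3 = 0"
    and en: "energy_height g S v = H" and am: "reduced_angular_momentum S v = l"
    and foc: "\<exists>\<phi>. parabola_focus g S v = sphere_point R \<phi> \<theta>"
    unfolding flight_points_def flight_parabolas_def by blast
  have nv: "(norm v)\<^sup>2 = (v $ 1)\<^sup>2 + (v $ 2)\<^sup>2"
    using v3 by (simp add: norm_vec_def L2_set_def sum_3)
  have circ: "(S $ 1)\<^sup>2 + (S $ 2)\<^sup>2 = (R * sin \<theta>)\<^sup>2"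
    and S3: "S $ 3 - (norm v)\<^sup>2 / (2 * g) = R * cos \<theta>"
    using foc sphere_point_azimuth_iff[OF assms(2)]
    by (simp_all add: parabola_focus_def focal_length_def e_z_def axis_def)
  have e: "(norm v)\<^sup>2 / (2 * g) + S $ 3 = H"
    using en by (simp add: energy_height_def)
  have "2 * ((norm v)\<^sup>2 / (2 * g)) = H - R * cos \<theta>"
    using e S3 by linarith
  then have K: "(v $ 1)\<^sup>2 + (v $ 2)\<^sup>2 = g * (H - R * cos \<theta>)"
    using assms(1) nv by (simp add: field_simps)
  have S3': "S $ 3 = (H + R * cos \<theta>) / 2"
    using e S3 by (simp add: field_simps)
  have "S $ 1 * v $ 2 - S $ 2 * v $ 1 = l"
    using am by (simp add: reduced_angular_momentum_def cross3_def)
  moreover have "p $ 1 = S $ 1 + t * v $ 1" "p $ 2 = S $ 2 + t * v $ 2"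
    "p $ 3 = (H + R * cos \<theta>) / 2 - g / 2 * t\<^sup>2"
    using v3 S3' by (simp_all add: p flight_curve_def e_z_def axis_def)
  ultimately show ?coordinates
    using circ K by blast
next
  assume ?coordinates
  then obtain x y u w t where circ: "x\<^sup>2 + y\<^sup>2 = (R * sin \<theta>)\<^sup>2"
    and K: "u\<^sup>2 + w\<^sup>2 = g * (H - R * cos \<theta>)" and am: "x * w - y * u = l"
    and p: "p $ 1 = x + t * u" "p $ 2 = y + t * w"
      "p $ 3 = (H + R * cos \<theta>) / 2 - g / 2 * t\<^sup>2"
    by blast
  define S v :: "real^3" where "S = vector [x, y, (H + R * cos \<theta>) / 2]"
    and "v = vector [u, w, 0]"
  have "(norm v)\<^sup>2 = g * (H - R * cos \<theta>)"
    by (simp add: K[symmetric] norm_vec_def L2_set_def sum_3 v_def)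
  then have F: "(norm v)\<^sup>2 / (2 * g) = (H - R * cos \<theta>) / 2"
    using assms(1) by simp
  have "\<exists>\<phi>. parabola_focus g S v = sphere_point R \<phi> \<theta>"
    unfolding sphere_point_azimuth_iff[OF assms(2)]
    using circ F
    by (simp add: parabola_focus_def focal_length_def e_z_def axis_def S_def field_simps)
  moreover have "energy_height g S v = H"
    unfolding energy_height_def F by (simp add: S_def field_simps)
  moreover have "reduced_angular_momentum S v = l"
    using am by (simp add: reduced_angular_momentum_def cross3_def S_def v_def)
  moreover have "v $ 3 = 0"
    by (simp add: v_def)
  moreover have "p = flight_curve g S v t"
    using p by (simp add: vec_eq_iff forall_3 flight_curve_def e_z_def axis_def S_def v_def)
  ultimately show "p \<in> flight_points g H R l \<theta>"
    unfolding flight_points_def flight_parabolas_def by blast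
qed

lemma lagrange_identity_2:
  fixes x y u w :: real
  shows "(x\<^sup>2 + y\<^sup>2) * (u\<^sup>2 + w\<^sup>2) = (x * u + y * w)\<^sup>2 + (x * w - y * u)\<^sup>2"
  by (simp add: power2_eq_square algebra_simps)

text \<open>Lagrange's identity with S replaced by S + t v: moving along v keeps the cross product
  and adds t times the squared length of v to the inner product.\<close>

lemma lagrange_identity_line:
  fixes x y u w t :: real
  shows "((x + t * u)\<^sup>2 + (y + t * w)\<^sup>2) * (u\<^sup>2 + w\<^sup>2) =
    (x * u + y * w + (u\<^sup>2 + w\<^sup>2) * t)\<^sup>2 + (x * w - y * u)\<^sup>2"
  by (simp add: power2_eq_square algebra_simps)

lemma line_time_squared_cases:
  fixes x y u w t :: real
  defines "K \<equiv> u\<^sup>2 + w\<^sup>2" and "l \<equiv> x * w - y * u"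
  assumes "K \<noteq> 0"
  defines "A \<equiv> sqrt (((x + t * u)\<^sup>2 + (y + t * w)\<^sup>2) * K - l\<^sup>2)"
    and "B \<equiv> sqrt ((x\<^sup>2 + y\<^sup>2) * K - l\<^sup>2)"
  shows "t\<^sup>2 = ((A + B) / K)\<^sup>2 \<or> t\<^sup>2 = ((A - B) / K)\<^sup>2"
proof -
  define d where "d = x * u + y * w"
  have A: "A = \<bar>d + K * t\<bar>"
    using lagrange_identity_line[of x t u y w] by (simp add: A_def K_def l_def d_def)
  have B: "B = \<bar>d\<bar>"
    using lagrange_identity_2[of x y u w] by (simp add: B_def K_def l_def d_def)
  \<comment> \<open>\<open>K * t\<close> is the difference of the two inner products whose absolute
    values are \<open>A\<close> and \<open>B\<close>. The four sign choices form two pairs of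
    opposite numbers, which squaring merges.\<close>
  have "K * t = A + B \<or> K * t = - (A + B) \<or> K * t = A - B \<or> K * t = - (A - B)"
    using A B by linarith
  then have "(K * t)\<^sup>2 = (A + B)\<^sup>2 \<or> (K * t)\<^sup>2 = (A - B)\<^sup>2"
    by (metis power2_minus)
  then show ?thesis
    using assms(3) by (simp add: power_divide power_mult_distrib field_simps)
qed

text \<open>The sign of \<open>b\<close> is left open, so that both roots of its equation can be
  inserted: one gives the upper sign in the height formula, the other the lower.\<close>

lemma ex_line_at_distance:
  fixes K l \<rho> r b :: real
  assumes "K > 0" and b: "b\<^sup>2 = \<rho>\<^sup>2 * K - l\<^sup>2" and r: "l\<^sup>2 \<le> r\<^sup>2 * K"
  shows "\<exists>x y u w. x\<^sup>2 + y\<^sup>2 = \<rho>\<^sup>2 \<and> u\<^sup>2 + w\<^sup>2 = K \<and> x * w - y * u = l \<and>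
    (x + (sqrt (r\<^sup>2 * K - l\<^sup>2) + b) / K * u)\<^sup>2 +
    (y + (sqrt (r\<^sup>2 * K - l\<^sup>2) + b) / K * w)\<^sup>2 = r\<^sup>2"
proof (intro exI conjI)
  define s where "s = sqrt K"
  have s: "s \<noteq> 0" "s\<^sup>2 = K"
    using assms(1) by (simp_all add: s_def)
  \<comment> \<open>With velocity (s, 0), the cross product \<open>l\<close> forces y = -l/s. Taking
    x = -b/s makes the initial inner product -b, so that at the chosen time it equals the square
    root.\<close>
  show circ: "(- b / s)\<^sup>2 + (- l / s)\<^sup>2 = \<rho>\<^sup>2"
    using s assms(1) b by (simp add: power_divide add_divide_distrib[symmetric])
  show "s\<^sup>2 + 0\<^sup>2 = K"
    by (simp add: s)
  show "(- b / s) * 0 - (- l / s) * s = l"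
    using s by simp
  have "- b / s + (sqrt (r\<^sup>2 * K - l\<^sup>2) + b) / K * s = sqrt (r\<^sup>2 * K - l\<^sup>2) / s"
    using s(1) by (simp add: s(2)[symmetric] power2_eq_square field_simps)
  then show "(- b / s + (sqrt (r\<^sup>2 * K - l\<^sup>2) + b) / K * s)\<^sup>2 +
      (- l / s + (sqrt (r\<^sup>2 * K - l\<^sup>2) + b) / K * 0)\<^sup>2 = r\<^sup>2"
    using s assms(1) r by (simp add: power_divide add_divide_distrib[symmetric])
qed

theorem theorem4p2:
  fixes g R H l\<^sub>z \<theta> :: real
  assumes "g > 0" and "R > 0" and "0 \<le> \<theta>" and "\<theta> \<le> pi"
    and "H - R * cos \<theta> > 0"
    and "g * R\<^sup>2 * (sin \<theta>)\<^sup>2 * (H - R * cos \<theta>) \<ge> l\<^sub>z\<^sup>2"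
  shows "(\<forall>r\<ge>0. (\<exists>p \<in> flight_points g H R l\<^sub>z \<theta>. axis_dist p = r) \<longrightarrow>
            r \<ge> \<bar>l\<^sub>z\<bar> / sqrt (g * (H - R * cos \<theta>))) \<and>
         (\<forall>r. r \<ge> \<bar>l\<^sub>z\<bar> / sqrt (g * (H - R * cos \<theta>)) \<longrightarrow>
            {p $ 3 | p. p \<in> flight_points g H R l\<^sub>z \<theta> \<and> axis_dist p = r}
              = {h_plus g H R l\<^sub>z r \<theta>, h_minus g H R l\<^sub>z r \<theta>})"
proof -
  define K \<rho> where "K = g * (H - R * cos \<theta>)" and "\<rho> = R * sin \<theta>"
  define A B where "A r = sqrt (r\<^sup>2 * K - l\<^sub>z\<^sup>2)" and "B = sqrt (\<rho>\<^sup>2 * K - l\<^sub>z\<^sup>2)" for r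
  define h where "h t = (H + R * cos \<theta>) / 2 - g / 2 * t\<^sup>2" for t
  have K: "K > 0"
    using assms by (simp add: K_def)
  have \<rho>: "0 \<le> R * sin \<theta>"
    using assms by (simp add: sin_ge_zero)
  \<comment> \<open>The last assumption of the theorem says that the radicand of \<open>B\<close> is
    nonnegative.\<close>
  have B2: "B\<^sup>2 = \<rho>\<^sup>2 * K - l\<^sub>z\<^sup>2"
    using assms(6) by (simp add: B_def K_def \<rho>_def power_mult_distrib mult_ac)
  have hp: "h_plus g H R l\<^sub>z r \<theta> = h ((A r + B) / K)"
    and hm: "h_minus g H R l\<^sub>z r \<theta> = h ((A r - B) / K)" for r
    by (simp_all add: h_plus_def h_minus_def h_def A_def B_def K_def \<rho>_def power_mult_distrib mult.assoc)
  note points = mem_flight_points_iff[OF assms(1) \<rho>, of _ H l\<^sub>z, folded K_def \<rho>_def h_def]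
  \<comment> \<open>The second conjunct of the theorem ranges over all real \<open>r\<close>; its
    lower bound already forces the sign.\<close>
  have nonneg: "0 \<le> r" if "\<bar>l\<^sub>z\<bar> / sqrt K \<le> r" for r
    using that K by (meson abs_ge_zero divide_nonneg_nonneg order_trans real_sqrt_ge_zero less_imp_le)
  have bound: "\<bar>l\<^sub>z\<bar> / sqrt K \<le> r \<longleftrightarrow> l\<^sub>z\<^sup>2 \<le> r\<^sup>2 * K" if "0 \<le> r" for r
  proof -
    \<comment> \<open>The absolute value on the right prepares the comparison of squares.\<close>
    have "\<bar>l\<^sub>z\<bar> / sqrt K \<le> r \<longleftrightarrow> \<bar>l\<^sub>z\<bar> \<le> \<bar>r * sqrt K\<bar>"
      using K that by (simp add: divide_le_eq)
    also have "\<dots> \<longleftrightarrow> l\<^sub>z\<^sup>2 \<le> r\<^sup>2 * K"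
      using K by (simp add: abs_le_square_iff power_mult_distrib)
    finally show ?thesis .
  qed
  have dist: "\<bar>l\<^sub>z\<bar> / sqrt K \<le> axis_dist p"
    and height: "p $ 3 = h ((A (axis_dist p) + B) / K) \<or> p $ 3 = h ((A (axis_dist p) - B) / K)"
    if "p \<in> flight_points g H R l\<^sub>z \<theta>" for p
  proof -
    obtain x y u w t where circ: "x\<^sup>2 + y\<^sup>2 = \<rho>\<^sup>2" and v: "u\<^sup>2 + w\<^sup>2 = K"
      and am: "x * w - y * u = l\<^sub>z" and p: "p $ 1 = x + t * u" "p $ 2 = y + t * w" "p $ 3 = h t"
      using \<open>p \<in> flight_points g H R l\<^sub>z \<theta>\<close> unfolding points by blast
    have r: "(x + t * u)\<^sup>2 + (y + t * w)\<^sup>2 = (axis_dist p)\<^sup>2"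
      by (simp add: axis_dist_def p)
    have "l\<^sub>z\<^sup>2 \<le> (axis_dist p)\<^sup>2 * K"
      using lagrange_identity_line[of x t u y w] unfolding r v am by simp
    then show "\<bar>l\<^sub>z\<bar> / sqrt K \<le> axis_dist p"
      by (simp add: bound axis_dist_def)
    have "t\<^sup>2 = ((A (axis_dist p) + B) / K)\<^sup>2 \<or> t\<^sup>2 = ((A (axis_dist p) - B) / K)\<^sup>2"
      using line_time_squared_cases[of u w t x y] K unfolding r v am circ A_def B_def by simp
    then show "p $ 3 = h ((A (axis_dist p) + B) / K) \<or> p $ 3 = h ((A (axis_dist p) - B) / K)"
      unfolding p(3) h_def by presburger
  qed
  have attained: "\<exists>p \<in> flight_points g H R l\<^sub>z \<theta>. axis_dist p = r \<and> p $ 3 = h ((A r + b) / K)"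
    if "\<bar>l\<^sub>z\<bar> / sqrt K \<le> r" and b: "b\<^sup>2 = \<rho>\<^sup>2 * K - l\<^sub>z\<^sup>2" for r b
  proof -
    define t where "t = (A r + b) / K"
    have r: "0 \<le> r" "l\<^sub>z\<^sup>2 \<le> r\<^sup>2 * K"
      using that nonneg bound by blast+
    obtain x y u w where line: "x\<^sup>2 + y\<^sup>2 = \<rho>\<^sup>2" "u\<^sup>2 + w\<^sup>2 = K" "x * w - y * u = l\<^sub>z"
      and d: "(x + t * u)\<^sup>2 + (y + t * w)\<^sup>2 = r\<^sup>2"
      using ex_line_at_distance[OF K b r(2)] unfolding t_def A_def by blast
    define p :: "real^3" where "p = vector [x + t * u, y + t * w, h t]"
    have p: "p $ 1 = x + t * u" "p $ 2 = y + t * w" "p $ 3 = h t"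
      by (simp_all add: p_def)
    have "p \<in> flight_points g H R l\<^sub>z \<theta>"
      unfolding points using line p by blast
    moreover have "axis_dist p = r"
      using d r(1) by (simp add: axis_dist_def p)
    ultimately show ?thesis
      using p(3) t_def by blast
  qed
  show ?thesis
    unfolding hp hm K_def[symmetric]
  proof (intro conjI allI impI set_eqI iffI)
    fix r z
    assume r: "\<bar>l\<^sub>z\<bar> / sqrt K \<le> r"
    let ?Z = "{p $ 3 | p. p \<in> flight_points g H R l\<^sub>z \<theta> \<and> axis_dist p = r}"
    have plus: "h ((A r + B) / K) \<in> ?Z"
      using attained[OF r B2] by (elim bexE conjE) (intro CollectI exI conjI, simp_all)
    \<comment> \<open>The choice \<open>b = - B\<close> has the same square as \<open>B\<close> and
      turns the sum into the difference.\<close>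
    have "\<exists>p \<in> flight_points g H R l\<^sub>z \<theta>. axis_dist p = r \<and> p $ 3 = h ((A r + - B) / K)"
      by (rule attained[OF r]) (simp add: B2)
    then have minus: "h ((A r - B) / K) \<in> ?Z"
      by (elim bexE conjE) (intro CollectI exI conjI, simp_all)
    show "z \<in> {h ((A r + B) / K), h ((A r - B) / K)}" if "z \<in> ?Z"
    proof -
      obtain p where "p \<in> flight_points g H R l\<^sub>z \<theta>" "axis_dist p = r" "z = p $ 3"
        using \<open>z \<in> ?Z\<close> by blast
      then show ?thesis
        using height[of p] by simp
    qed
    show "z \<in> ?Z" if "z \<in> {h ((A r + B) / K), h ((A r - B) / K)}"
      using that by (elim insertE emptyE) (simp_all only: plus minus)
  qed (use dist in blast)
qed

end
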